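(* Let $\operatorname{cst}$ be a cyclic permutation statistic and let $\operatorname{st}$ be a shuffle-compatible (linear) permutation statistic. Given a cyclic permutation $[\pi]$, let $$v_{[\pi]}=\sum_{\bar{\pi}\in[\pi]}\bar{\pi}_{\operatorname{st}}\in\mathcal{A}_{\operatorname{st}}.$$ Suppose that $v_{[\pi]}=v_{[\sigma]}$ whenever $[\pi]$ and $[\sigma]$ are $\operatorname{cst}$-equivalent, and that the family $\{v_{[\pi]}\}$ (one vector for each $\operatorname{cst}$-equivalence class of cyclic permutations) is linearly independent. Then $\operatorname{cst}$ is cyclic shuffle-compatible, and the map $\psi_{\operatorname{cst}}\colon\mathcal{A}^{\mathrm{cyc}}_{\operatorname{cst}}\rightarrow\mathcal{A}_{\operatorname{st}}$ given by $$\psi_{\operatorname{cst}}([\pi]_{\operatorname{cst}})=v_{[\pi]}$$ extends linearly to a $\mathbb{Q}$-algebra isomorphism from $\mathcal{A}^{\mathrm{cyc}}_{\operatorname{cst}}$ to the span of $\{v_{[\pi]}\}$, a subalgebra of $\mathcal{A}_{\operatorname{st}}$.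
   Context: A (linear) permutation of length $n\ge 0$ is a sequence $\pi=\pi_1\cdots\pi_n$ of $n$ distinct positive integers (not necessarily $1,\dots,n$); $|\pi|=n$; $\mathfrak{P}_n$ is the set of permutations of length $n$. Two permutations are disjoint if they have no letter in common, and have the same relative order if they have the same standardization (replace the $i$th smallest letter by $i$). For disjoint $\pi\in\mathfrak{P}_m$, $\sigma\in\mathfrak{P}_n$, a shuffle of $\pi$ and $\sigma$ is a $\tau\in\mathfrak{P}_{m+n}$ having both $\pi$ and $\sigma$ as subsequences; $\operatorname{Sh}(\pi,\sigma)$ is the set of shuffles. A (linear) permutation statistic is a function $\operatorname{st}$ on permutations with $\operatorname{st}\pi=\operatorname{st}\sigma$ whenever $\pi,\sigma$ have the same relative order. It is shuffle-compatible if for disjoint $\pi,\sigma$ the multiset $\{\{\operatorname{st}\tau:\tau\in\operatorname{Sh}(\pi,\sigma)\}\}$ depends only on $\operatorname{st}\pi$, $\operatorname{st}\sigma$, $|\pi|$, $|\sigma|$. Permutations $\pi,\sigma$ are $\operatorname{st}$-equivalent if $\operatorname{st}\pi=\operatorname{st}\sigma$ and $|\pi|=|\sigma|$; $\pi_{\operatorname{st}}$ is the equivalence class of $\pi$. For $\operatorname{st}$ shuffle-compatible, the shuffle algebra $\mathcal{A}_{\operatorname{st}}$ is the $\mathbb{Q}$-vector space with basis the $\operatorname{st}$-equivalence classes and multiplication $\pi_{\operatorname{st}}\sigma_{\operatorname{st}}=\sum_{\tau\in\operatorname{Sh}(\pi,\sigma)}\tau_{\operatorname{st}}$ for disjoint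 representatives $\pi,\sigma$. The cyclic permutation $[\pi]$ is the set of all rotations of $\pi$; its length is $|\pi|$. A cyclic permutation statistic is a function $\operatorname{cst}$ on cyclic permutations with $\operatorname{cst}[\pi]=\operatorname{cst}[\sigma]$ whenever $\pi,\sigma$ have the same relative order. For disjoint $\pi\in\mathfrak{P}_m$, $\sigma\in\mathfrak{P}_n$, the set $\operatorname{cSh}([\pi],[\sigma])$ of cyclic shuffles consists of all $[\tau]$ such that $\tau\in\operatorname{Sh}(\bar\pi,\bar\sigma)$ for some $\bar\pi\in[\pi]$, $\bar\sigma\in[\sigma]$. The statistic $\operatorname{cst}$ is cyclic shuffle-compatible if for disjoint $\pi,\sigma$ the multiset $\{\{\operatorname{cst}[\tau]:[\tau]\in\operatorname{cSh}([\pi],[\sigma])\}\}$ depends only on $\operatorname{cst}[\pi]$, $\operatorname{cst}[\sigma]$, $|\pi|$, $|\sigma|$. Cyclic permutations $[\pi],[\sigma]$ are $\operatorname{cst}$-equivalent if $\operatorname{cst}[\pi]=\operatorname{cst}[\sigma]$ and $|\pi|=|\sigma|$; $[\pi]_{\operatorname{cst}}$ is the class of $[\pi]$. $\mathcal{A}^{\mathrm{cyc}}_{\operatorname{cst}}$ is the $\mathbb{Q}$-vector space with basis the $\operatorname{cst}$-equivalence classes; when $\operatorname{cst}$ is cyclic shuffle-compatible it is a $\mathbb{Q}$-algebra (the cyclic shuffle algebra) with multiplication $[\pi]_{\operatorname{cst}}[\sigma]_{\operatorname{cst}}=\sum_{[\tau]\in\operatorname{cSh}([\pi],[\sigma])}[\tau]_{\operatorname{cst}}$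 for $\pi,\sigma$ disjoint. *)

theory Defs
  imports
    "HOL-Library.Poly_Mapping"
    "HOL-Library.Multiset"
    "HOL-Library.Sublist"
    "HOL-Algebra.Algebraic_Closure_Type"
    "HOL-Algebra.QuotRing"
begin

section \<open>Linear permutations and shuffles\<close>

definition lin_perm :: "nat list \<Rightarrow> bool" where
  "lin_perm \<pi> \<longleftrightarrow> distinct \<pi> \<and> (\<forall>a \<in> set \<pi>. 0 < a)"

definition disjoint_perms :: "nat list \<Rightarrow> nat list \<Rightarrow> bool" where
  "disjoint_perms \<pi> \<sigma> \<longleftrightarrow> lin_perm \<pi> \<and> lin_perm \<sigma> \<and> set \<pi> \<inter> set \<sigma> = {}"

definition standardization :: "nat list \<Rightarrow> nat list" where
  "standardization \<pi> = map (\<lambda>a. card {b \<in> set \<pi>. b \<le> a}) \<pi>"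

definition same_relative_order :: "nat list \<Rightarrow> nat list \<Rightarrow> bool" where
  "same_relative_order \<pi> \<sigma> \<longleftrightarrow> standardization \<pi> = standardization \<sigma>"

definition Sh :: "nat list \<Rightarrow> nat list \<Rightarrow> nat list set" where
  "Sh \<pi> \<sigma> = {\<tau>. lin_perm \<tau> \<and> length \<tau> = length \<pi> + length \<sigma> \<and> subseq \<pi> \<tau> \<and> subseq \<sigma> \<tau>}"

section \<open>Linear permutation statistics\<close>

definition perm_statistic :: "(nat list \<Rightarrow> 'a) \<Rightarrow> bool" where
  "perm_statistic st \<longleftrightarrow>
     (\<forall>\<pi> \<sigma>. lin_perm \<pi> \<and> lin_perm \<sigma> \<and> same_relative_order \<pi> \<sigma> \<longrightarrow> st \<pi> = st \<sigma>)"

definition shuffle_compatible :: "(nat list \<Rightarrow> 'a) \<Rightarrow> bool" where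
  "shuffle_compatible st \<longleftrightarrow>
     (\<forall>\<pi> \<sigma> \<pi>' \<sigma>'. disjoint_perms \<pi> \<sigma> \<and> disjoint_perms \<pi>' \<sigma>' \<and>
        st \<pi> = st \<pi>' \<and> st \<sigma> = st \<sigma>' \<and> length \<pi> = length \<pi>' \<and> length \<sigma> = length \<sigma>' \<longrightarrow>
        image_mset st (mset_set (Sh \<pi> \<sigma>)) = image_mset st (mset_set (Sh \<pi>' \<sigma>')))"

definition st_equiv :: "(nat list \<Rightarrow> 'a) \<Rightarrow> nat list \<Rightarrow> nat list \<Rightarrow> bool" where
  "st_equiv st \<pi> \<sigma> \<longleftrightarrow> st \<pi> = st \<sigma> \<and> length \<pi> = length \<sigma>"

definition st_class :: "(nat list \<Rightarrow> 'a) \<Rightarrow> nat list \<Rightarrow> nat list set" where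
  "st_class st \<pi> = {\<sigma>. lin_perm \<sigma> \<and> st_equiv st \<pi> \<sigma>}"

section \<open>Cyclic permutations, cyclic shuffles and cyclic statistics\<close>

definition cyc :: "nat list \<Rightarrow> nat list set" where
  "cyc \<pi> = {rotate k \<pi> | k. True}"

definition cyc_perms :: "nat list set set" where
  "cyc_perms = cyc ` {\<pi>. lin_perm \<pi>}"

text \<open>All rotations of a permutation have the same length.\<close>

definition cyc_length :: "nat list set \<Rightarrow> nat" where
  "cyc_length P = the_elem (length ` P)"

definition cSh :: "nat list set \<Rightarrow> nat list set \<Rightarrow> nat list set set" where
  "cSh P Q = {cyc \<tau> | \<tau> \<pi> \<sigma>. \<pi> \<in> P \<and> \<sigma> \<in> Q \<and> \<tau> \<in> Sh \<pi> \<sigma>}"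

definition cyc_perm_statistic :: "(nat list set \<Rightarrow> 'b) \<Rightarrow> bool" where
  "cyc_perm_statistic cst \<longleftrightarrow>
     (\<forall>\<pi> \<sigma>. lin_perm \<pi> \<and> lin_perm \<sigma> \<and> same_relative_order \<pi> \<sigma> \<longrightarrow> cst (cyc \<pi>) = cst (cyc \<sigma>))"

definition cyc_shuffle_compatible :: "(nat list set \<Rightarrow> 'b) \<Rightarrow> bool" where
  "cyc_shuffle_compatible cst \<longleftrightarrow>
     (\<forall>\<pi> \<sigma> \<pi>' \<sigma>'. disjoint_perms \<pi> \<sigma> \<and> disjoint_perms \<pi>' \<sigma>' \<and>
        cst (cyc \<pi>) = cst (cyc \<pi>') \<and> cst (cyc \<sigma>) = cst (cyc \<sigma>') \<and>
        length \<pi> = length \<pi>' \<and> length \<sigma> = length \<sigma>' \<longrightarrow>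
        image_mset cst (mset_set (cSh (cyc \<pi>) (cyc \<sigma>))) =
        image_mset cst (mset_set (cSh (cyc \<pi>') (cyc \<sigma>'))))"

definition cst_equiv :: "(nat list set \<Rightarrow> 'b) \<Rightarrow> nat list set \<Rightarrow> nat list set \<Rightarrow> bool" where
  "cst_equiv cst P Q \<longleftrightarrow> cst P = cst Q \<and> cyc_length P = cyc_length Q"

definition cst_class :: "(nat list set \<Rightarrow> 'b) \<Rightarrow> nat list set \<Rightarrow> nat list set set" where
  "cst_class cst P = {Q \<in> cyc_perms. cst_equiv cst P Q}"

section \<open>Rational algebras with a given basis\<close>

text \<open>
  The rational vector space with basis \<open>B\<close> consists of the finitely supported functions
  \<open>'k \<Rightarrow>\<^sub>0 rat\<close> with support in \<open>B\<close>; the basis vector of \<open>b\<close> is \<open>Poly_Mapping.single b 1\<close>.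
  The multiplication that the library puts on \<open>'k \<Rightarrow>\<^sub>0 rat\<close> for additive \<open>'k\<close> plays no role here.
\<close>

definition scaleQ :: "rat \<Rightarrow> ('k \<Rightarrow>\<^sub>0 rat) \<Rightarrow> ('k \<Rightarrow>\<^sub>0 rat)" where
  "scaleQ c f = Poly_Mapping.map ((*) c) f"

lemma lookup_scaleQ [simp]: "Poly_Mapping.lookup (scaleQ c f) k = c * Poly_Mapping.lookup f k"
  by (simp add: scaleQ_def Poly_Mapping.map.rep_eq when_def)

global_interpretation freeQ: vector_space scaleQ
  by unfold_locales (auto intro!: poly_mapping_eqI simp: lookup_add algebra_simps)

abbreviation rat_field :: "rat ring" where
  "rat_field \<equiv> ring_of_type_algebra"

text \<open>
  \<open>m b c\<close> is the product of the basis vectors of \<open>b\<close> and \<open>c\<close>, extended bilinearly; the basis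
  vector of \<open>e\<close> is the unit.
\<close>

definition based_algebra ::
    "'k set \<Rightarrow> 'k \<Rightarrow> ('k \<Rightarrow> 'k \<Rightarrow> 'k \<Rightarrow>\<^sub>0 rat) \<Rightarrow> (rat, 'k \<Rightarrow>\<^sub>0 rat) module" where
  "based_algebra B e m =
     \<lparr>carrier = {f. Poly_Mapping.keys f \<subseteq> B},
      monoid.mult = (\<lambda>f g. \<Sum>b \<in> Poly_Mapping.keys f. \<Sum>c \<in> Poly_Mapping.keys g.
                      scaleQ (Poly_Mapping.lookup f b * Poly_Mapping.lookup g c) (m b c)),
      one = Poly_Mapping.single e 1,
      zero = 0,
      add = (+),
      module.smult = scaleQ\<rparr>"

text \<open>
  The locale \<open>algebra\<close> of HOL-Algebra comprises associative, commutative and unital algebras.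
  Shuffle algebras are of this kind: \<open>Sh \<pi> \<sigma> = Sh \<sigma> \<pi>\<close>, and the class of the empty permutation
  is the unit.
\<close>

definition is_subalgebra :: "'s set \<Rightarrow> ('r, 'm) ring_scheme \<Rightarrow> ('r, 's) module \<Rightarrow> bool" where
  "is_subalgebra V R A \<longleftrightarrow> algebra R A \<and> subring V A \<and> submodule V R A"

definition is_algebra_iso ::
    "('r, 'm) ring_scheme \<Rightarrow> ('r, 's) module \<Rightarrow> ('r, 't) module \<Rightarrow> ('s \<Rightarrow> 't) \<Rightarrow> bool" where
  "is_algebra_iso R A B h \<longleftrightarrow>
     algebra R A \<and> algebra R B \<and> h \<in> ring_iso A B \<and>
     (\<forall>c \<in> carrier R. \<forall>x \<in> carrier A. h (c \<odot>\<^bsub>A\<^esub> x) = c \<odot>\<^bsub>B\<^esub> h x)"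

section \<open>Shuffle algebras\<close>

text \<open>
  The product of two classes is computed from an arbitrary choice of disjoint representatives;
  \<open>shuffle_prod_eq\<close> and \<open>cyc_shuffle_prod_eq\<close> below show that for (cyclic) shuffle-compatible
  statistics the choice does not matter.
\<close>

definition shuffle_prod ::
    "(nat list \<Rightarrow> 'a) \<Rightarrow> nat list set \<Rightarrow> nat list set \<Rightarrow> nat list set \<Rightarrow>\<^sub>0 rat" where
  "shuffle_prod st B C =
     (let (\<pi>, \<sigma>) = (SOME (\<pi>, \<sigma>). \<pi> \<in> B \<and> \<sigma> \<in> C \<and> disjoint_perms \<pi> \<sigma>)
      in \<Sum>\<tau> \<in> Sh \<pi> \<sigma>. Poly_Mapping.single (st_class st \<tau>) 1)"

definition shuffle_algebra ::
    "(nat list \<Rightarrow> 'a) \<Rightarrow> (rat, nat list set \<Rightarrow>\<^sub>0 rat) module" where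
  "shuffle_algebra st =
     based_algebra (st_class st ` {\<pi>. lin_perm \<pi>}) (st_class st []) (shuffle_prod st)"

definition cyc_shuffle_prod ::
    "(nat list set \<Rightarrow> 'b) \<Rightarrow> nat list set set \<Rightarrow> nat list set set \<Rightarrow> nat list set set \<Rightarrow>\<^sub>0 rat" where
  "cyc_shuffle_prod cst B C =
     (let (\<pi>, \<sigma>) = (SOME (\<pi>, \<sigma>). cyc \<pi> \<in> B \<and> cyc \<sigma> \<in> C \<and> disjoint_perms \<pi> \<sigma>)
      in \<Sum>T \<in> cSh (cyc \<pi>) (cyc \<sigma>). Poly_Mapping.single (cst_class cst T) 1)"

definition cyc_shuffle_algebra ::
    "(nat list set \<Rightarrow> 'b) \<Rightarrow> (rat, nat list set set \<Rightarrow>\<^sub>0 rat) module" where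
  "cyc_shuffle_algebra cst =
     based_algebra (cst_class cst ` cyc_perms) (cst_class cst (cyc [])) (cyc_shuffle_prod cst)"

definition cyc_vec :: "(nat list \<Rightarrow> 'a) \<Rightarrow> nat list set \<Rightarrow> nat list set \<Rightarrow>\<^sub>0 rat" where
  "cyc_vec st P = (\<Sum>\<pi> \<in> P. Poly_Mapping.single (st_class st \<pi>) 1)"

section \<open>Well-definedness of the products\<close>

lemma subseq_imp_subset: "subseq xs ys \<Longrightarrow> set xs \<subseteq> set ys"
  by (induction rule: list_emb.induct) auto

lemma set_Sh:
  assumes "disjoint_perms \<pi> \<sigma>" "\<tau> \<in> Sh \<pi> \<sigma>"
  shows "set \<tau> = set \<pi> \<union> set \<sigma>"
proof -
  have "set \<pi> \<union> set \<sigma> \<subseteq> set \<tau>"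
    using assms(2) subseq_imp_subset by (fastforce simp: Sh_def)
  moreover have "card (set \<pi> \<union> set \<sigma>) = card (set \<tau>)"
    using assms by (auto simp: Sh_def disjoint_perms_def lin_perm_def card_Un_disjoint distinct_card)
  ultimately show ?thesis by (metis List.finite_set card_subset_eq)
qed

lemma finite_Sh:
  assumes "disjoint_perms \<pi> \<sigma>"
  shows "finite (Sh \<pi> \<sigma>)"
proof (rule finite_subset)
  show "Sh \<pi> \<sigma> \<subseteq> {xs. set xs \<subseteq> set \<pi> \<union> set \<sigma> \<and> length xs = length \<pi> + length \<sigma>}"
    using set_Sh[OF assms] by (auto simp: Sh_def)
qed (simp add: finite_lists_length_eq)

lemma cyc_altdef: "cyc \<pi> = (\<lambda>k. rotate k \<pi>) ` {..length \<pi>}"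
proof -
  have "rotate k \<pi> \<in> (\<lambda>k. rotate k \<pi>) ` {..length \<pi>}" for k
  proof (cases "\<pi> = []")
    case False
    have "rotate k \<pi> = rotate (k mod length \<pi>) \<pi>" by (rule rotate_conv_mod)
    then show ?thesis using False by (simp add: less_imp_le)
  qed auto
  then show ?thesis unfolding cyc_def by auto
qed

lemma finite_cyc: "finite (cyc \<pi>)"
  by (simp add: cyc_altdef)

lemma self_in_cyc: "\<pi> \<in> cyc \<pi>"
  unfolding cyc_def by (auto intro: exI[of _ 0])

lemma cyc_length_cyc [simp]: "cyc_length (cyc \<pi>) = length \<pi>"
proof -
  have "length ` cyc \<pi> = {length \<pi>}"
    using self_in_cyc[of \<pi>] by (auto simp: cyc_def)
  then show ?thesis by (simp add: cyc_length_def)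
qed

lemma disjoint_perms_cyc:
  assumes "disjoint_perms \<pi> \<sigma>" "\<pi>' \<in> cyc \<pi>" "\<sigma>' \<in> cyc \<sigma>"
  shows "disjoint_perms \<pi>' \<sigma>'"
  using assms by (auto simp: disjoint_perms_def lin_perm_def cyc_def)

lemma finite_cSh:
  assumes "disjoint_perms \<pi> \<sigma>"
  shows "finite (cSh (cyc \<pi>) (cyc \<sigma>))"
proof -
  have "cSh (cyc \<pi>) (cyc \<sigma>) = (\<Union>\<pi>' \<in> cyc \<pi>. \<Union>\<sigma>' \<in> cyc \<sigma>. cyc ` Sh \<pi>' \<sigma>')"
    by (auto simp: cSh_def)
  then show ?thesis
    using finite_cyc finite_Sh disjoint_perms_cyc[OF assms] by auto
qed

lemma cyc_length_cSh:
  assumes "T \<in> cSh (cyc \<pi>) (cyc \<sigma>)"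
  shows "cyc_length T = length \<pi> + length \<sigma>"
proof -
  obtain \<tau> \<pi>' \<sigma>' where "T = cyc \<tau>" "\<pi>' \<in> cyc \<pi>" "\<sigma>' \<in> cyc \<sigma>" "\<tau> \<in> Sh \<pi>' \<sigma>'"
    using assms unfolding cSh_def by blast
  then show ?thesis by (auto simp: Sh_def cyc_def[of \<pi>] cyc_def[of \<sigma>])
qed

lemma sum_image_mset_cong:
  fixes F :: "'b \<Rightarrow> 'c::comm_monoid_add"
  assumes "image_mset f (mset_set A) = image_mset f (mset_set A')"
  shows "(\<Sum>x\<in>A. F (f x)) = (\<Sum>x\<in>A'. F (f x))"
proof -
  have "(\<Sum>x\<in>D. F (f x)) = sum_mset (image_mset F (image_mset f (mset_set D)))" for D
    by (simp add: sum_unfold_sum_mset multiset.map_comp comp_def)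
  then show ?thesis using assms by simp
qed

lemma shuffle_prod_eq:
  assumes "shuffle_compatible st" and \<pi>\<sigma>: "disjoint_perms \<pi> \<sigma>"
  shows "shuffle_prod st (st_class st \<pi>) (st_class st \<sigma>) =
           (\<Sum>\<tau> \<in> Sh \<pi> \<sigma>. Poly_Mapping.single (st_class st \<tau>) 1)"
proof -
  define p where "p = (SOME (\<pi>', \<sigma>'). \<pi>' \<in> st_class st \<pi> \<and> \<sigma>' \<in> st_class st \<sigma> \<and> disjoint_perms \<pi>' \<sigma>')"
  obtain \<pi>' \<sigma>' where p: "p = (\<pi>', \<sigma>')" by fastforce
  have "case p of (\<pi>', \<sigma>') \<Rightarrow> \<pi>' \<in> st_class st \<pi> \<and> \<sigma>' \<in> st_class st \<sigma> \<and> disjoint_perms \<pi>' \<sigma>'"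
    unfolding p_def
    by (rule someI[of _ "(\<pi>, \<sigma>)"]) (use \<pi>\<sigma> in \<open>auto simp: st_class_def st_equiv_def disjoint_perms_def\<close>)
  then have *: "st \<pi> = st \<pi>'" "st \<sigma> = st \<sigma>'" "length \<pi> = length \<pi>'" "length \<sigma> = length \<sigma>'"
    "disjoint_perms \<pi>' \<sigma>'"
    by (auto simp: p st_class_def st_equiv_def)
  define F :: "'a \<Rightarrow> nat list set \<Rightarrow>\<^sub>0 rat" where
    "F s = Poly_Mapping.single {\<rho>. lin_perm \<rho> \<and> s = st \<rho> \<and> length \<pi> + length \<sigma> = length \<rho>} 1" for s
  have "image_mset st (mset_set (Sh \<pi>' \<sigma>')) = image_mset st (mset_set (Sh \<pi> \<sigma>))"
    using assms * unfolding shuffle_compatible_def by metis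
  then have "(\<Sum>\<tau> \<in> Sh \<pi>' \<sigma>'. F (st \<tau>)) = (\<Sum>\<tau> \<in> Sh \<pi> \<sigma>. F (st \<tau>))"
    by (rule sum_image_mset_cong)
  moreover have "(\<Sum>\<tau> \<in> Sh \<pi>' \<sigma>'. F (st \<tau>)) = (\<Sum>\<tau> \<in> Sh \<pi>' \<sigma>'. Poly_Mapping.single (st_class st \<tau>) 1)"
    by (intro sum.cong) (use * in \<open>auto simp: F_def st_class_def st_equiv_def Sh_def\<close>)
  moreover have "(\<Sum>\<tau> \<in> Sh \<pi> \<sigma>. F (st \<tau>)) = (\<Sum>\<tau> \<in> Sh \<pi> \<sigma>. Poly_Mapping.single (st_class st \<tau>) 1)"
    by (intro sum.cong) (auto simp: F_def st_class_def st_equiv_def Sh_def)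
  ultimately show ?thesis
    by (simp add: shuffle_prod_def flip: p_def) (simp add: p)
qed

lemma cyc_shuffle_prod_eq:
  assumes "cyc_shuffle_compatible cst" and \<pi>\<sigma>: "disjoint_perms \<pi> \<sigma>"
  shows "cyc_shuffle_prod cst (cst_class cst (cyc \<pi>)) (cst_class cst (cyc \<sigma>)) =
           (\<Sum>T \<in> cSh (cyc \<pi>) (cyc \<sigma>). Poly_Mapping.single (cst_class cst T) 1)"
proof -
  define p where "p = (SOME (\<pi>', \<sigma>'). cyc \<pi>' \<in> cst_class cst (cyc \<pi>) \<and>
                         cyc \<sigma>' \<in> cst_class cst (cyc \<sigma>) \<and> disjoint_perms \<pi>' \<sigma>')"
  obtain \<pi>' \<sigma>' where p: "p = (\<pi>', \<sigma>')" by fastforce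
  have "case p of (\<pi>', \<sigma>') \<Rightarrow> cyc \<pi>' \<in> cst_class cst (cyc \<pi>) \<and>
          cyc \<sigma>' \<in> cst_class cst (cyc \<sigma>) \<and> disjoint_perms \<pi>' \<sigma>'"
    unfolding p_def
    by (rule someI[of _ "(\<pi>, \<sigma>)"])
       (use \<pi>\<sigma> in \<open>auto simp: cst_class_def cst_equiv_def disjoint_perms_def cyc_perms_def\<close>)
  then have *: "cst (cyc \<pi>) = cst (cyc \<pi>')" "cst (cyc \<sigma>) = cst (cyc \<sigma>')"
    "length \<pi> = length \<pi>'" "length \<sigma> = length \<sigma>'" "disjoint_perms \<pi>' \<sigma>'"
    by (auto simp: p cst_class_def cst_equiv_def)
  define F :: "'a \<Rightarrow> nat list set set \<Rightarrow>\<^sub>0 rat" where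
    "F s = Poly_Mapping.single
             {Q \<in> cyc_perms. s = cst Q \<and> length \<pi> + length \<sigma> = cyc_length Q} 1" for s
  have "image_mset cst (mset_set (cSh (cyc \<pi>') (cyc \<sigma>'))) =
        image_mset cst (mset_set (cSh (cyc \<pi>) (cyc \<sigma>)))"
    using assms * unfolding cyc_shuffle_compatible_def by metis
  then have "(\<Sum>T \<in> cSh (cyc \<pi>') (cyc \<sigma>'). F (cst T)) = (\<Sum>T \<in> cSh (cyc \<pi>) (cyc \<sigma>). F (cst T))"
    by (rule sum_image_mset_cong)
  moreover have "(\<Sum>T \<in> cSh (cyc \<pi>') (cyc \<sigma>'). F (cst T)) =
                 (\<Sum>T \<in> cSh (cyc \<pi>') (cyc \<sigma>'). Poly_Mapping.single (cst_class cst T) 1)"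
    by (intro sum.cong) (use * in \<open>auto simp: F_def cst_class_def cst_equiv_def cyc_length_cSh\<close>)
  moreover have "(\<Sum>T \<in> cSh (cyc \<pi>) (cyc \<sigma>). F (cst T)) =
                 (\<Sum>T \<in> cSh (cyc \<pi>) (cyc \<sigma>). Poly_Mapping.single (cst_class cst T) 1)"
    by (intro sum.cong) (auto simp: F_def cst_class_def cst_equiv_def cyc_length_cSh)
  ultimately show ?thesis
    by (simp add: cyc_shuffle_prod_def flip: p_def) (simp add: p)
qed

end

theory Submission
  imports Defs
begin

text \<open>
  Everything rests on one identity in the shuffle algebra: for disjoint \<open>\<pi>\<close> and \<open>\<sigma>\<close>, the product
  of the vectors of \<open>[\<pi>]\<close> and \<open>[\<sigma>]\<close> is the sum of the vectors of the cyclic shuffles \<open>[\<tau>]\<close> of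
  \<open>[\<pi>]\<close> and \<open>[\<sigma>]\<close> (\<open>cyc_vec_mult\<close>). Expanding the product gives a sum over the linear shuffles of
  all rotations of \<open>\<pi>\<close> with all rotations of \<open>\<sigma>\<close>. A permutation \<open>\<tau>\<close> of the joint letters occurs in
  it exactly when its restrictions to the letters of \<open>\<pi>\<close> and of \<open>\<sigma>\<close> are rotations of \<open>\<pi>\<close> and \<open>\<sigma>\<close>,
  and then it occurs once, since the restrictions determine the two factors. Restricting a rotation
  of \<open>\<tau>\<close> yields rotations of the restrictions of \<open>\<tau>\<close>, so the set of these \<open>\<tau>\<close> is a disjoint union of
  full rotation classes, namely the cyclic shuffles.

  If \<open>\<pi>\<close> and \<open>\<sigma>\<close> are replaced by permutations with the same cyclic statistic and lengths, the left
  side of the identity does not change, hence neither does the sum on the right. As the vectors are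
  linearly independent, equal sums have equal multisets of summands, and a vector determines the
  value of the cyclic statistic. This is cyclic shuffle-compatibility
  (\<open>cyc_shuffle_compatible\<close>).

  Independence also makes the linear extension \<open>psi\<close> a bijection onto the span (\<open>bij_betw_psi\<close>), and
  the same identity makes it multiplicative (\<open>psi_mult\<close>), after disjoint representatives of two given
  classes have been found by shifting the letters of one of them. So the span is closed under
  multiplication. The linear shuffle algebra is an algebra because iterated shuffles of three
  permutations do not depend on the bracketing (\<open>shuffle_algebra_is_algebra\<close>); the algebra laws of the
  cyclic one are pulled back along the injective map \<open>psi\<close>.
\<close>

section \<open>Bilinear products on free rational vector spaces\<close>

abbreviation basis_vec :: "'k \<Rightarrow> 'k \<Rightarrow>\<^sub>0 rat" where
  "basis_vec k \<equiv> Poly_Mapping.single k 1"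

definition lin_ext :: "('k \<Rightarrow> 'l \<Rightarrow>\<^sub>0 rat) \<Rightarrow> ('k \<Rightarrow>\<^sub>0 rat) \<Rightarrow> ('l \<Rightarrow>\<^sub>0 rat)" where
  "lin_ext V f = (\<Sum>k \<in> Poly_Mapping.keys f. scaleQ (Poly_Mapping.lookup f k) (V k))"

text \<open>
  Enlarging the index set beyond the support makes sums for different vectors comparable; this is
  how additivity of \<open>lin_ext\<close> is obtained.
\<close>

lemma lin_ext_superset:
  assumes "finite S" "Poly_Mapping.keys f \<subseteq> S"
  shows "lin_ext V f = (\<Sum>k \<in> S. scaleQ (Poly_Mapping.lookup f k) (V k))"
  unfolding lin_ext_def
  by (rule sum.mono_neutral_left) (use assms in \<open>auto simp: in_keys_iff\<close>)

lemma lin_ext_add: "lin_ext V (f + g) = lin_ext V f + lin_ext V g"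
proof -
  let ?S = "Poly_Mapping.keys f \<union> Poly_Mapping.keys g"
  have "lin_ext V h = (\<Sum>k \<in> ?S. scaleQ (Poly_Mapping.lookup h k) (V k))"
    if "Poly_Mapping.keys h \<subseteq> ?S" for h
    using that by (intro lin_ext_superset) auto
  then show ?thesis
    using Poly_Mapping.keys_add[of f g]
    by (simp add: lookup_add freeQ.scale_left_distrib sum.distrib)
qed

lemma keys_scaleQ: "Poly_Mapping.keys (scaleQ c f) \<subseteq> Poly_Mapping.keys f"
  by (auto simp: in_keys_iff)

lemma lin_ext_scaleQ: "lin_ext V (scaleQ c f) = scaleQ c (lin_ext V f)"
  using lin_ext_superset[OF finite_keys keys_scaleQ, of V c f]
  by (simp add: lin_ext_def freeQ.scale_sum_right)

lemma linear_scaleQI: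
  assumes "\<And>f g. F (f + g) = F f + F g" "\<And>c f. F (scaleQ c f) = scaleQ c (F f)"
  shows "Vector_Spaces.linear scaleQ scaleQ F"
  using assms by (auto simp: Vector_Spaces.linear_iff intro: freeQ.vector_space_axioms)

lemma linear_lin_ext: "Vector_Spaces.linear scaleQ scaleQ (lin_ext V)"
  by (rule linear_scaleQI) (simp_all add: lin_ext_add lin_ext_scaleQ)

lemma lin_ext_basis_vec [simp]: "lin_ext V (basis_vec k) = V k"
  by (simp add: lin_ext_def)

lemma lin_ext_sum: "lin_ext V (\<Sum>i \<in> I. f i) = (\<Sum>i \<in> I. lin_ext V (f i))"
  by (rule module_hom.sum[OF linear_lin_ext[unfolded Vector_Spaces.linear_iff_module_hom]])

lemma keys_sum_subset:
  assumes "\<And>i. i \<in> I \<Longrightarrow> Poly_Mapping.keys (f i) \<subseteq> B"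
  shows "Poly_Mapping.keys (\<Sum>i \<in> I. f i) \<subseteq> B"
  using assms
proof (induction I rule: infinite_finite_induct)
  case (insert i I)
  then show ?case using Poly_Mapping.keys_add[of "f i" "\<Sum>i \<in> I. f i"] by auto
qed auto

lemma keys_lin_ext_subset:
  assumes "\<And>k. k \<in> Poly_Mapping.keys f \<Longrightarrow> Poly_Mapping.keys (V k) \<subseteq> B"
  shows "Poly_Mapping.keys (lin_ext V f) \<subseteq> B"
  unfolding lin_ext_def by (intro keys_sum_subset order.trans[OF keys_scaleQ] assms)

lemma lin_ext_basis_vec_id [simp]: "lin_ext basis_vec f = f"
proof (rule poly_mapping_eqI)
  fix k
  have "Poly_Mapping.lookup (lin_ext basis_vec f) k =
      (\<Sum>j \<in> Poly_Mapping.keys f. if j = k then Poly_Mapping.lookup f j else 0)"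
    by (auto simp: lin_ext_def lookup_sum lookup_single when_def simp del: sum.delta intro!: sum.cong)
  then show "Poly_Mapping.lookup (lin_ext basis_vec f) k = Poly_Mapping.lookup f k"
    by (simp add: in_keys_iff)
qed

lemma span_basis_vec: "freeQ.span (basis_vec ` B) = {f. Poly_Mapping.keys f \<subseteq> B}"
proof
  have "freeQ.subspace {f :: 'a \<Rightarrow>\<^sub>0 rat. Poly_Mapping.keys f \<subseteq> B}"
    by (auto simp: freeQ.subspace_def
        dest!: subsetD[OF Poly_Mapping.keys_add] subsetD[OF keys_scaleQ])
  then show "freeQ.span (basis_vec ` B) \<subseteq> {f. Poly_Mapping.keys f \<subseteq> B}"
    by (intro freeQ.span_minimal) auto
  show "{f. Poly_Mapping.keys f \<subseteq> B} \<subseteq> freeQ.span (basis_vec ` B)"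
  proof clarify
    fix f :: "'a \<Rightarrow>\<^sub>0 rat" assume "Poly_Mapping.keys f \<subseteq> B"
    then have "lin_ext basis_vec f \<in> freeQ.span (basis_vec ` B)"
      unfolding lin_ext_def by (intro freeQ.span_sum freeQ.span_scale freeQ.span_base) auto
    then show "f \<in> freeQ.span (basis_vec ` B)" by simp
  qed
qed

lemma linear_eq_on_keys:
  assumes "Vector_Spaces.linear scaleQ scaleQ F" "Vector_Spaces.linear scaleQ scaleQ G"
    and "\<And>b. b \<in> B \<Longrightarrow> F (basis_vec b) = G (basis_vec b)"
    and "Poly_Mapping.keys f \<subseteq> B"
  shows "F f = G f"
proof -
  interpret P: vector_space_pair scaleQ scaleQ ..
  show ?thesis
    by (rule P.linear_eq_on_span[OF assms(1,2), of "basis_vec ` B"])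
      (use assms(3,4) in \<open>auto simp: span_basis_vec\<close>)
qed

definition bilin_ext ::
    "('k \<Rightarrow> 'l \<Rightarrow> 'm \<Rightarrow>\<^sub>0 rat) \<Rightarrow> ('k \<Rightarrow>\<^sub>0 rat) \<Rightarrow> ('l \<Rightarrow>\<^sub>0 rat) \<Rightarrow> ('m \<Rightarrow>\<^sub>0 rat)" where
  "bilin_ext m f g = lin_ext (\<lambda>b. lin_ext (m b) g) f"

lemma linear_bilin_ext_left: "Vector_Spaces.linear scaleQ scaleQ (\<lambda>f. bilin_ext m f g)"
  unfolding bilin_ext_def by (rule linear_lin_ext)

lemma linear_bilin_ext_right: "Vector_Spaces.linear scaleQ scaleQ (bilin_ext m f)"
  by (rule linear_scaleQI)
    (simp_all add: bilin_ext_def lin_ext_add lin_ext_scaleQ lin_ext_def[of _ f]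
      freeQ.scale_right_distrib sum.distrib freeQ.scale_sum_right mult.commute)

lemma bilin_ext_basis_vec [simp]: "bilin_ext m (basis_vec b) (basis_vec c) = m b c"
  by (simp add: bilin_ext_def)

lemma bilin_ext_sum_basis_vec:
  "bilin_ext m (\<Sum>i \<in> I. basis_vec (f i)) (\<Sum>j \<in> J. basis_vec (g j)) = (\<Sum>i \<in> I. \<Sum>j \<in> J. m (f i) (g j))"
  by (simp add: bilin_ext_def lin_ext_sum)

lemma keys_bilin_ext_subset:
  assumes "\<And>b c. b \<in> B \<Longrightarrow> c \<in> B \<Longrightarrow> Poly_Mapping.keys (m b c) \<subseteq> B"
    and "Poly_Mapping.keys f \<subseteq> B" "Poly_Mapping.keys g \<subseteq> B"
  shows "Poly_Mapping.keys (bilin_ext m f g) \<subseteq> B"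
  unfolding bilin_ext_def using assms(2,3) by (intro keys_lin_ext_subset assms(1)) auto

lemma bilin_eq_on_keys:
  assumes "\<And>g. Vector_Spaces.linear scaleQ scaleQ (\<lambda>f. F f g)"
    and "\<And>f. Vector_Spaces.linear scaleQ scaleQ (F f)"
    and "\<And>g. Vector_Spaces.linear scaleQ scaleQ (\<lambda>f. G f g)"
    and "\<And>f. Vector_Spaces.linear scaleQ scaleQ (G f)"
    and "\<And>b c. b \<in> B \<Longrightarrow> c \<in> C \<Longrightarrow> F (basis_vec b) (basis_vec c) = G (basis_vec b) (basis_vec c)"
    and "Poly_Mapping.keys f \<subseteq> B" "Poly_Mapping.keys g \<subseteq> C"
  shows "F f g = G f g"
proof -
  have "F (basis_vec b) g = G (basis_vec b) g" if "b \<in> B" for b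
    by (rule linear_eq_on_keys[OF assms(2,4) _ assms(7)]) (use that assms(5) in blast)
  then show ?thesis
    by (intro linear_eq_on_keys[OF assms(1,3) _ assms(6)])
qed

lemma linear_comp:
  assumes "Vector_Spaces.linear scaleQ scaleQ F" "Vector_Spaces.linear scaleQ scaleQ G"
  shows "Vector_Spaces.linear scaleQ scaleQ (\<lambda>x. F (G x))"
  using Vector_Spaces.linear_compose[OF assms(2,1)] by (simp add: comp_def)

text \<open>
  The bilinear extension is the multiplication of a based algebra, so the rules for \<open>bilin_ext\<close> apply.
\<close>

lemma based_algebra_simps:
  "carrier (based_algebra B e m) = {f. Poly_Mapping.keys f \<subseteq> B}"
  "monoid.mult (based_algebra B e m) = bilin_ext m"
  "one (based_algebra B e m) = basis_vec e"
  "zero (based_algebra B e m) = 0"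
  "add (based_algebra B e m) = (+)"
  "module.smult (based_algebra B e m) = scaleQ"
  by (simp_all add: based_algebra_def bilin_ext_def lin_ext_def fun_eq_iff
      freeQ.scale_sum_right mult.commute)

text \<open>
  Commutativity, the unit law and associativity are identities between maps that are linear in each
  argument, so that they hold everywhere once they hold on basis vectors.
\<close>

lemma based_algebra_is_algebra:
  assumes e: "e \<in> B"
    and closed: "\<And>b c. b \<in> B \<Longrightarrow> c \<in> B \<Longrightarrow> Poly_Mapping.keys (m b c) \<subseteq> B"
    and comm: "\<And>b c. b \<in> B \<Longrightarrow> c \<in> B \<Longrightarrow> m b c = m c b"
    and unit: "\<And>b. b \<in> B \<Longrightarrow> m e b = basis_vec b"
    and assoc: "\<And>b c d. b \<in> B \<Longrightarrow> c \<in> B \<Longrightarrow> d \<in> B \<Longrightarrow>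
       bilin_ext m (m b c) (basis_vec d) = bilin_ext m (basis_vec b) (m c d)"
  shows "algebra rat_field (based_algebra B e m)"
proof -
  let ?A = "based_algebra B e m"
  note lin = linear_bilin_ext_left linear_bilin_ext_right linear_comp
  have comm': "bilin_ext m f g = bilin_ext m g f"
    if "Poly_Mapping.keys f \<subseteq> B" "Poly_Mapping.keys g \<subseteq> B" for f g
    by (rule bilin_eq_on_keys[OF lin(1,2) lin(2,1) _ that]) (simp add: comm)
  have unit': "bilin_ext m (basis_vec e) f = f" if "Poly_Mapping.keys f \<subseteq> B" for f
  proof -
    have "bilin_ext m (basis_vec e) f = lin_ext basis_vec f"
      by (rule linear_eq_on_keys[OF lin(2) linear_lin_ext _ that]) (simp add: unit)
    then show ?thesis by simp
  qed
  have assoc': "bilin_ext m (bilin_ext m f g) h = bilin_ext m f (bilin_ext m g h)"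
    if f: "Poly_Mapping.keys f \<subseteq> B" and g: "Poly_Mapping.keys g \<subseteq> B"
      and h: "Poly_Mapping.keys h \<subseteq> B" for f g h
  proof (rule linear_eq_on_keys[OF _ _ _ h])
    fix d assume d: "d \<in> B"
    show "bilin_ext m (bilin_ext m f g) (basis_vec d) = bilin_ext m f (bilin_ext m g (basis_vec d))"
      by (rule bilin_eq_on_keys[OF _ _ _ _ _ f g])
        (use d assoc in \<open>auto intro: lin linear_comp[OF linear_bilin_ext_left linear_bilin_ext_left]
            linear_comp[OF linear_bilin_ext_left linear_bilin_ext_right]
            linear_comp[OF linear_bilin_ext_right linear_bilin_ext_left]\<close>)
  qed (auto intro: lin linear_comp[OF linear_bilin_ext_right linear_bilin_ext_right])
  have distrib: "bilin_ext m (f + g) h = bilin_ext m f h + bilin_ext m g h" for f g h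
    by (simp add: bilin_ext_def lin_ext_add)
  have add_closed: "Poly_Mapping.keys (f + g) \<subseteq> B"
    if "Poly_Mapping.keys f \<subseteq> B" "Poly_Mapping.keys g \<subseteq> B" for f g :: "'a \<Rightarrow>\<^sub>0 rat"
    using that by (rule order.trans[OF Poly_Mapping.keys_add Un_least])
  have "abelian_group ?A"
  proof (rule abelian_groupI)
    fix f assume "f \<in> carrier ?A"
    then show "\<exists>g \<in> carrier ?A. g \<oplus>\<^bsub>?A\<^esub> f = \<zero>\<^bsub>?A\<^esub>"
      by (intro bexI[of _ "-f"]) (auto simp: based_algebra_simps)
  qed (simp_all add: based_algebra_simps add_ac add_closed)
  moreover have "comm_monoid ?A"
    by (rule comm_monoidI)
      (use e in \<open>simp_all add: based_algebra_simps assoc' unit'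
          keys_bilin_ext_subset[OF closed] comm'[of _ "basis_vec e"]\<close>, rule comm')
  ultimately have cring: "cring ?A"
    by (intro cringI) (simp_all add: based_algebra_simps distrib)
  show ?thesis
  proof (rule algebraI[OF _ cring])
    show "cring (rat_field :: rat ring)" by (rule cring_from_type_algebra)
  qed (simp_all add: based_algebra_simps ring_of_type_algebra_def bilin_ext_def lin_ext_scaleQ
      freeQ.scale_left_distrib freeQ.scale_right_distrib order.trans[OF keys_scaleQ])
qed

lemma based_algebra_a_inv:
  assumes "algebra rat_field (based_algebra B e m)" "Poly_Mapping.keys f \<subseteq> B"
  shows "\<ominus>\<^bsub>based_algebra B e m\<^esub> f = - f"
proof -
  interpret algebra rat_field "based_algebra B e m" by fact
  show ?thesis
    by (rule M.minus_equality) (use assms(2) in \<open>auto simp: based_algebra_simps\<close>)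
qed

lemma subalgebra_imp_algebra:
  assumes "is_subalgebra V R A"
  shows "algebra R (A\<lparr>carrier := V\<rparr>)"
proof -
  interpret algebra R A using assms by (simp add: is_subalgebra_def)
  have V: "subring V A" "submodule V R A" using assms by (simp_all add: is_subalgebra_def)
  have sub: "V \<subseteq> carrier A" using subringE(1)[OF V(1)] .
  have "module R (A\<lparr>carrier := V\<rparr>)"
    by (rule submodule.submodule_is_module[OF V(2) module])
  moreover have "cring (A\<lparr>carrier := V\<rparr>)"
    using ring.subcring_iff[OF cring.axioms(1)[OF M_cring] sub] M_cring cring.subcringI'[OF M_cring V(1)] by simp
  ultimately show ?thesis
    unfolding algebra_def algebra_axioms_def by (simp add: subsetD[OF sub] smult_assoc2)
qed

section \<open>Shuffles\<close>

text \<open>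
  In a sequence without repetitions a subsequence is determined by its set of letters. Hence shuffles
  can be described by restriction to the letters of each factor (\<open>Sh_eq\<close>), which is a form that is
  convenient for iterated shuffles and for rotations.
\<close>

lemma filter_subseq_distinct:
  assumes "subseq xs ys" "distinct ys"
  shows "filter (\<lambda>x. x \<in> set xs) ys = xs"
  using assms
proof (induction rule: list_emb.induct)
  case (list_emb_Cons xs ys y)
  then show ?case using subseq_imp_subset by fastforce
next
  case (list_emb_Cons2 x y xs ys)
  then have "filter (\<lambda>a. a \<in> set (x # xs)) ys = filter (\<lambda>a. a \<in> set xs) ys"
    by (intro filter_cong) auto
  with list_emb_Cons2 show ?case by simp
qed auto

lemma Sh_eq:
  assumes "disjoint_perms \<pi> \<sigma>"
  shows "Sh \<pi> \<sigma> = {\<tau>. distinct \<tau> \<and> set \<tau> = set \<pi> \<union> set \<sigma> \<and>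
           filter (\<lambda>x. x \<in> set \<pi>) \<tau> = \<pi> \<and> filter (\<lambda>x. x \<in> set \<sigma>) \<tau> = \<sigma>}" (is "_ = ?R")
proof
  show "Sh \<pi> \<sigma> \<subseteq> ?R"
    using set_Sh[OF assms] by (auto simp: Sh_def lin_perm_def filter_subseq_distinct)
  show "?R \<subseteq> Sh \<pi> \<sigma>"
  proof clarify
    fix \<tau> assume \<tau>: "distinct \<tau>" "set \<tau> = set \<pi> \<union> set \<sigma>"
      "filter (\<lambda>x. x \<in> set \<pi>) \<tau> = \<pi>" "filter (\<lambda>x. x \<in> set \<sigma>) \<tau> = \<sigma>"
    have "length \<tau> = card (set \<pi> \<union> set \<sigma>)" using \<tau> by (metis distinct_card)
    also have "\<dots> = length \<pi> + length \<sigma>"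
      using assms by (simp add: disjoint_perms_def lin_perm_def card_Un_disjoint distinct_card)
    finally have "length \<tau> = length \<pi> + length \<sigma>" .
    moreover have "subseq \<pi> \<tau>" "subseq \<sigma> \<tau>" using \<tau>(3,4) by (metis subseq_filter_left)+
    ultimately show "\<tau> \<in> Sh \<pi> \<sigma>"
      using assms \<tau> by (auto simp: Sh_def disjoint_perms_def lin_perm_def)
  qed
qed

lemma Sh_commute: "Sh \<pi> \<sigma> = Sh \<sigma> \<pi>"
  by (auto simp: Sh_def)

lemma disjoint_perms_commute: "disjoint_perms \<pi> \<sigma> \<longleftrightarrow> disjoint_perms \<sigma> \<pi>"
  by (auto simp: disjoint_perms_def)

lemma Sh_Nil_left:
  assumes "lin_perm \<sigma>"
  shows "Sh [] \<sigma> = {\<sigma>}"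
proof -
  have "disjoint_perms [] \<sigma>" using assms by (simp add: disjoint_perms_def lin_perm_def)
  then show ?thesis
    using assms by (auto simp: Sh_eq lin_perm_def)
qed

text \<open>
  For pairwise disjoint arguments these are the shuffles of three permutations.
\<close>

definition Sh3 :: "nat list \<Rightarrow> nat list \<Rightarrow> nat list \<Rightarrow> nat list set" where
  "Sh3 \<pi> \<sigma> \<rho> = {\<omega>. distinct \<omega> \<and> set \<omega> = set \<pi> \<union> set \<sigma> \<union> set \<rho> \<and>
     filter (\<lambda>x. x \<in> set \<pi>) \<omega> = \<pi> \<and> filter (\<lambda>x. x \<in> set \<sigma>) \<omega> = \<sigma> \<and> filter (\<lambda>x. x \<in> set \<rho>) \<omega> = \<rho>}"

lemma Sh3_rotate: "Sh3 \<pi> \<sigma> \<rho> = Sh3 \<sigma> \<rho> \<pi>"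
  by (auto simp: Sh3_def)

lemma disjoint_perms_Sh:
  assumes "disjoint_perms \<pi> \<sigma>" "disjoint_perms \<pi> \<rho>" "disjoint_perms \<sigma> \<rho>" "\<tau> \<in> Sh \<pi> \<sigma>"
  shows "disjoint_perms \<tau> \<rho>"
  using set_Sh[OF assms(1,4)] assms by (auto simp: disjoint_perms_def Sh_def)

text \<open>
  A threefold shuffle \<open>\<omega>\<close> comes from exactly one intermediate shuffle \<open>\<tau>\<close>, the restriction of \<open>\<omega>\<close> to
  the letters of \<open>\<pi>\<close> and \<open>\<sigma>\<close>. The right side is symmetric in the three factors, which is why shuffle
  products are associative.
\<close>

lemma sum_Sh_Sh:
  fixes F :: "nat list \<Rightarrow> 'c :: comm_monoid_add"
  assumes d: "disjoint_perms \<pi> \<sigma>" "disjoint_perms \<pi> \<rho>" "disjoint_perms \<sigma> \<rho>"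
  shows "(\<Sum>\<tau> \<in> Sh \<pi> \<sigma>. \<Sum>\<omega> \<in> Sh \<tau> \<rho>. F \<omega>) = (\<Sum>\<omega> \<in> Sh3 \<pi> \<sigma> \<rho>. F \<omega>)"
proof -
  note d' = disjoint_perms_Sh[OF d]
  have "Sh3 \<pi> \<sigma> \<rho> = (\<Union>\<tau> \<in> Sh \<pi> \<sigma>. Sh \<tau> \<rho>)"
  proof (intro equalityI subsetI)
    fix \<omega> assume \<omega>: "\<omega> \<in> Sh3 \<pi> \<sigma> \<rho>"
    define \<tau> where "\<tau> = filter (\<lambda>x. x \<in> set \<pi> \<union> set \<sigma>) \<omega>"
    have set\<tau>: "set \<tau> = set \<pi> \<union> set \<sigma>" using \<omega> by (auto simp: \<tau>_def Sh3_def)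
    have "filter (\<lambda>x. x \<in> set \<pi>) \<tau> = filter (\<lambda>x. x \<in> set \<pi>) \<omega>"
      "filter (\<lambda>x. x \<in> set \<sigma>) \<tau> = filter (\<lambda>x. x \<in> set \<sigma>) \<omega>"
      unfolding \<tau>_def filter_filter by (auto intro: filter_cong)
    then have \<tau>: "\<tau> \<in> Sh \<pi> \<sigma>"
      using \<omega> set\<tau> by (auto simp: Sh_eq[OF d(1)] Sh3_def \<tau>_def)
    moreover have "filter (\<lambda>x. x \<in> set \<tau>) \<omega> = \<tau>"
      by (simp add: set\<tau>) (simp add: \<tau>_def)
    then have "\<omega> \<in> Sh \<tau> \<rho>"
      using \<omega> set\<tau> by (simp add: Sh_eq[OF d'[OF \<tau>]] Sh3_def)
    ultimately show "\<omega> \<in> (\<Union>\<tau> \<in> Sh \<pi> \<sigma>. Sh \<tau> \<rho>)" by blast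
  next
    fix \<omega> assume "\<omega> \<in> (\<Union>\<tau> \<in> Sh \<pi> \<sigma>. Sh \<tau> \<rho>)"
    then obtain \<tau> where \<tau>: "\<tau> \<in> Sh \<pi> \<sigma>" and \<omega>: "\<omega> \<in> Sh \<tau> \<rho>" by blast
    have set\<tau>: "set \<tau> = set \<pi> \<union> set \<sigma>" using set_Sh[OF d(1) \<tau>] .
    have eq: "filter (\<lambda>x. x \<in> set \<tau>) \<omega> = \<tau>" using \<omega> by (simp add: Sh_eq[OF d'[OF \<tau>]])
    have "filter (\<lambda>x. x \<in> set \<pi>) \<omega> = filter (\<lambda>x. x \<in> set \<pi>) \<tau>"
      "filter (\<lambda>x. x \<in> set \<sigma>) \<omega> = filter (\<lambda>x. x \<in> set \<sigma>) \<tau>"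
      by (subst eq[symmetric], simp only: filter_filter, rule filter_cong, use set\<tau> in auto)+
    then show "\<omega> \<in> Sh3 \<pi> \<sigma> \<rho>"
      using \<tau> \<omega> set\<tau> by (simp add: Sh3_def Sh_eq[OF d(1)] Sh_eq[OF d'[OF \<tau>]])
  qed
  moreover have "Sh \<tau> \<rho> \<inter> Sh \<tau>' \<rho> = {}" if "\<tau> \<in> Sh \<pi> \<sigma>" "\<tau>' \<in> Sh \<pi> \<sigma>" "\<tau> \<noteq> \<tau>'" for \<tau> \<tau>'
    using that set_Sh[OF d(1)] by (auto simp: Sh_eq[OF d'])
  ultimately show ?thesis
    using finite_Sh[OF d(1)] finite_Sh[OF d'] by (simp add: sum.UNION_disjoint)
qed

lemma standardization_shift: "standardization (map (\<lambda>a. a + N) \<pi>) = standardization \<pi>"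
proof -
  have "{b \<in> (\<lambda>a. a + N) ` set \<pi>. b \<le> a + N} = (\<lambda>a. a + N) ` {b \<in> set \<pi>. b \<le> a}" for a
    by auto
  then show ?thesis
    by (simp add: standardization_def card_image)
qed

text \<open>
  Adding a constant to all letters keeps the relative order and moves them past any finite set. This
  supplies disjoint representatives of equivalence classes.
\<close>

lemma ex_same_order_disjoint:
  assumes "lin_perm \<pi>" "finite A"
  obtains \<pi>' where "lin_perm \<pi>'" "same_relative_order \<pi>' \<pi>" "set \<pi>' \<inter> A = {}"
proof -
  define \<pi>' where "\<pi>' = map (\<lambda>a. a + Max (insert 0 A)) \<pi>"
  have "a + Max (insert 0 A) \<notin> A" if "0 < a" for a
  proof
    assume "a + Max (insert 0 A) \<in> A"
    then have "a + Max (insert 0 A) \<le> Max (insert 0 A)" using assms(2) by (intro Max_ge) auto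
    then show False using that by simp
  qed
  then have "lin_perm \<pi>'" "set \<pi>' \<inter> A = {}"
    using assms(1) by (auto simp: \<pi>'_def lin_perm_def distinct_map)
  moreover have "same_relative_order \<pi>' \<pi>"
    by (simp add: same_relative_order_def \<pi>'_def standardization_shift)
  ultimately show thesis using that by blast
qed

lemma same_relative_order_length: "same_relative_order \<pi> \<sigma> \<Longrightarrow> length \<pi> = length \<sigma>"
  unfolding same_relative_order_def standardization_def by (drule arg_cong[of _ _ length]) simp

section \<open>The shuffle algebra\<close>

abbreviation st_classes :: "(nat list \<Rightarrow> 'a) \<Rightarrow> nat list set set" where
  "st_classes st \<equiv> st_class st ` {\<pi>. lin_perm \<pi>}"

lemma st_class_representative:
  assumes "perm_statistic st" "b \<in> st_classes st" "finite A"
  obtains \<pi> where "lin_perm \<pi>" "b = st_class st \<pi>" "set \<pi> \<inter> A = {}"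
proof -
  obtain \<pi> where \<pi>: "lin_perm \<pi>" "b = st_class st \<pi>" using assms(2) by blast
  obtain \<pi>' where \<pi>': "lin_perm \<pi>'" "same_relative_order \<pi>' \<pi>" "set \<pi>' \<inter> A = {}"
    using ex_same_order_disjoint[OF \<pi>(1) assms(3)] .
  have "st \<pi>' = st \<pi>" using assms(1) \<pi> \<pi>' by (auto simp: perm_statistic_def)
  then have "b = st_class st \<pi>'"
    using \<pi>(2) same_relative_order_length[OF \<pi>'(2)] by (simp add: st_class_def st_equiv_def)
  then show thesis using that \<pi>' by blast
qed

lemma shuffle_algebra_is_algebra:
  assumes "perm_statistic st" "shuffle_compatible st"
  shows "algebra rat_field (shuffle_algebra st)"
  unfolding shuffle_algebra_def
proof (rule based_algebra_is_algebra)
  note prod = shuffle_prod_eq[OF assms(2)]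
  show "st_class st [] \<in> st_classes st" by (auto simp: lin_perm_def)
  fix b c assume "b \<in> st_classes st" "c \<in> st_classes st"
  obtain \<pi> where \<pi>: "lin_perm \<pi>" "b = st_class st \<pi>"
    using st_class_representative[OF assms(1) \<open>b \<in> st_classes st\<close>, of "{}"] by auto
  obtain \<sigma> where \<sigma>: "lin_perm \<sigma>" "c = st_class st \<sigma>" "set \<sigma> \<inter> set \<pi> = {}"
    using st_class_representative[OF assms(1) \<open>c \<in> st_classes st\<close>, of "set \<pi>"] by auto
  have d: "disjoint_perms \<pi> \<sigma>" using \<pi> \<sigma> by (auto simp: disjoint_perms_def)
  show "Poly_Mapping.keys (shuffle_prod st b c) \<subseteq> st_classes st"
    unfolding \<pi> \<sigma> prod[OF d] by (rule keys_sum_subset) (auto simp: Sh_def)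
  show "shuffle_prod st b c = shuffle_prod st c b"
    unfolding \<pi> \<sigma> using d prod Sh_commute disjoint_perms_commute by metis
  have "disjoint_perms [] \<pi>" using \<pi> by (simp add: disjoint_perms_def lin_perm_def)
  then show "shuffle_prod st (st_class st []) b = basis_vec b"
    by (simp add: prod \<pi> Sh_Nil_left)
  fix a assume "a \<in> st_classes st"
  obtain \<rho> where \<rho>: "lin_perm \<rho>" "a = st_class st \<rho>" "set \<rho> \<inter> (set \<pi> \<union> set \<sigma>) = {}"
    using st_class_representative[OF assms(1) \<open>a \<in> st_classes st\<close>, of "set \<pi> \<union> set \<sigma>"] by auto
  have d': "disjoint_perms \<pi> \<rho>" "disjoint_perms \<sigma> \<rho>" "disjoint_perms \<rho> \<pi>" "disjoint_perms \<sigma> \<pi>"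
    using \<pi> \<sigma> \<rho> by (auto simp: disjoint_perms_def)
  have "bilin_ext (shuffle_prod st) (shuffle_prod st b c) (basis_vec a) =
      (\<Sum>\<tau> \<in> Sh \<pi> \<sigma>. shuffle_prod st (st_class st \<tau>) (st_class st \<rho>))"
    by (simp add: \<pi> \<sigma> \<rho> prod[OF d] bilin_ext_def lin_ext_sum)
  also have "\<dots> = (\<Sum>\<omega> \<in> Sh3 \<pi> \<sigma> \<rho>. basis_vec (st_class st \<omega>))"
    by (simp add: prod[OF disjoint_perms_Sh[OF d d'(1,2)]] sum_Sh_Sh[OF d d'(1,2)])
  also have "\<dots> = (\<Sum>\<omega> \<in> Sh3 \<sigma> \<rho> \<pi>. basis_vec (st_class st \<omega>))"
    by (simp add: Sh3_rotate[of \<pi>])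
  also have "\<dots> = (\<Sum>\<tau> \<in> Sh \<sigma> \<rho>. \<Sum>\<omega> \<in> Sh \<tau> \<pi>. basis_vec (st_class st \<omega>))"
    by (simp add: sum_Sh_Sh[OF d'(2,4,3)])
  also have "\<dots> = (\<Sum>\<tau> \<in> Sh \<sigma> \<rho>. shuffle_prod st (st_class st \<pi>) (st_class st \<tau>))"
    using prod disjoint_perms_Sh[OF d'(2,4,3)] 
    by (intro sum.cong refl) (metis Sh_commute disjoint_perms_commute)
  also have "\<dots> = bilin_ext (shuffle_prod st) (basis_vec b) (shuffle_prod st c a)"
    by (simp add: \<pi> \<sigma> \<rho> prod[OF d'(2)] bilin_ext_def lin_ext_sum)
  finally show "bilin_ext (shuffle_prod st) (shuffle_prod st b c) (basis_vec a) =
      bilin_ext (shuffle_prod st) (basis_vec b) (shuffle_prod st c a)" .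
qed

section \<open>Rotations and cyclic shuffles\<close>

lemma cyc_eq_if_mem:
  assumes "\<tau> \<in> cyc \<pi>"
  shows "cyc \<tau> = cyc \<pi>"
proof -
  obtain k where k: "\<tau> = rotate k \<pi>" using assms by (auto simp: cyc_def)
  have "\<exists>j. rotate j \<tau> = \<pi>"
  proof (cases "\<pi> = []")
    case False
    \<comment> \<open>A further \<open>length \<pi> * k - k\<close> steps make up a whole number of turns.\<close>
    then have "k \<le> length \<pi> * k" by (cases \<pi>) auto
    then have "rotate (length \<pi> * k - k) \<tau> = rotate (length \<pi> * k) \<pi>"
      by (simp add: k rotate_rotate)
    also have "\<dots> = \<pi>" by (subst rotate_conv_mod) simp
    finally show ?thesis by blast
  qed (simp add: k)
  then obtain j where j: "\<pi> = rotate j \<tau>" by blast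
  have "cyc \<tau> \<subseteq> cyc \<pi>" unfolding k by (auto simp: cyc_def rotate_rotate)
  moreover have "cyc \<pi> \<subseteq> cyc \<tau>" unfolding j by (auto simp: cyc_def rotate_rotate)
  ultimately show ?thesis by blast
qed

lemma set_cyc: "\<tau> \<in> cyc \<pi> \<Longrightarrow> set \<tau> = set \<pi>"
  by (auto simp: cyc_def)

lemma lin_perm_cyc: "lin_perm \<pi> \<Longrightarrow> \<tau> \<in> cyc \<pi> \<Longrightarrow> lin_perm \<tau>"
  by (auto simp: cyc_def lin_perm_def)

text \<open>
  Moving the first letter to the end either does the same to the restriction or, if this letter is
  removed, does not affect the restriction at all.
\<close>

lemma filter_rotate1_cyc: "filter P (rotate1 xs) \<in> cyc (filter P xs)"
proof (cases xs)
  case (Cons x ys)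
  show ?thesis
  proof (cases "P x")
    case True
    then have "filter P (rotate1 xs) = rotate 1 (filter P xs)" by (simp add: Cons)
    then show ?thesis unfolding cyc_def by blast
  qed (simp add: Cons self_in_cyc)
qed (simp add: self_in_cyc)

lemma filter_rotate_cyc: "filter P (rotate k xs) \<in> cyc (filter P xs)"
proof (induction k)
  case (Suc k)
  have "filter P (rotate (Suc k) xs) \<in> cyc (filter P (rotate k xs))"
    using filter_rotate1_cyc[of P "rotate k xs"] by simp
  then show ?case using cyc_eq_if_mem[OF Suc.IH] by simp
qed (simp add: self_in_cyc)

lemma cyc_Nil: "cyc [] = {[]}"
  by (auto simp: cyc_def)

lemma cyc_Nil_in_cyc_perms: "cyc [] \<in> cyc_perms"
  by (auto simp: cyc_perms_def lin_perm_def)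

definition rot_shuffles :: "nat list \<Rightarrow> nat list \<Rightarrow> nat list set" where
  "rot_shuffles \<pi> \<sigma> = (\<Union>(\<pi>', \<sigma>') \<in> cyc \<pi> \<times> cyc \<sigma>. Sh \<pi>' \<sigma>')"

lemma rot_shuffles_eq:
  assumes "disjoint_perms \<pi> \<sigma>"
  shows "rot_shuffles \<pi> \<sigma> = {\<tau>. distinct \<tau> \<and> set \<tau> = set \<pi> \<union> set \<sigma> \<and>
           filter (\<lambda>x. x \<in> set \<pi>) \<tau> \<in> cyc \<pi> \<and> filter (\<lambda>x. x \<in> set \<sigma>) \<tau> \<in> cyc \<sigma>}"
proof -
  have "\<tau> \<in> Sh \<pi>' \<sigma>' \<longleftrightarrow> distinct \<tau> \<and> set \<tau> = set \<pi> \<union> set \<sigma> \<and>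
      filter (\<lambda>x. x \<in> set \<pi>) \<tau> = \<pi>' \<and> filter (\<lambda>x. x \<in> set \<sigma>) \<tau> = \<sigma>'"
    if "\<pi>' \<in> cyc \<pi>" "\<sigma>' \<in> cyc \<sigma>" for \<tau> \<pi>' \<sigma>'
    using Sh_eq[OF disjoint_perms_cyc[OF assms that]] set_cyc that by auto
  then show ?thesis by (auto simp: rot_shuffles_def)
qed

text \<open>
  Rotating \<open>\<tau>\<close> only rotates its restrictions to the letters of \<open>\<pi>\<close> and of \<open>\<sigma>\<close>.
\<close>

lemma rot_shuffles_cyc_closed:
  assumes "disjoint_perms \<pi> \<sigma>" "\<tau> \<in> rot_shuffles \<pi> \<sigma>"
  shows "cyc \<tau> \<subseteq> rot_shuffles \<pi> \<sigma>"
proof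
  fix \<tau>' assume "\<tau>' \<in> cyc \<tau>"
  then obtain k where k: "\<tau>' = rotate k \<tau>" by (auto simp: cyc_def)
  have "cyc (filter (\<lambda>x. x \<in> set \<pi>) \<tau>) = cyc \<pi>" "cyc (filter (\<lambda>x. x \<in> set \<sigma>) \<tau>) = cyc \<sigma>"
    using assms by (simp_all add: rot_shuffles_eq cyc_eq_if_mem)
  then show "\<tau>' \<in> rot_shuffles \<pi> \<sigma>"
    using assms(2) filter_rotate_cyc[of _ k \<tau>] by (auto simp: rot_shuffles_eq[OF assms(1)] k)
qed

lemma cSh_eq_image: "cSh (cyc \<pi>) (cyc \<sigma>) = cyc ` rot_shuffles \<pi> \<sigma>"
  by (auto simp: cSh_def rot_shuffles_def)

text \<open>
  Both sides sum \<open>F\<close> over \<open>rot_shuffles \<pi> \<sigma>\<close>. On the left this set is partitioned by the restrictions of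
  its members to the letters of \<open>\<pi>\<close> and of \<open>\<sigma>\<close>, on the right by rotation classes.
\<close>

lemma sum_rot_shuffles:
  fixes F :: "nat list \<Rightarrow> 'c :: comm_monoid_add"
  assumes d: "disjoint_perms \<pi> \<sigma>"
  shows "(\<Sum>\<pi>' \<in> cyc \<pi>. \<Sum>\<sigma>' \<in> cyc \<sigma>. \<Sum>\<tau> \<in> Sh \<pi>' \<sigma>'. F \<tau>) = (\<Sum>T \<in> cSh (cyc \<pi>) (cyc \<sigma>). \<Sum>\<tau> \<in> T. F \<tau>)"
proof -
  note d' = disjoint_perms_cyc[OF d]
  have disj: "Sh \<pi>1 \<sigma>1 \<inter> Sh \<pi>2 \<sigma>2 = {}"
    if "\<pi>1 \<in> cyc \<pi>" "\<sigma>1 \<in> cyc \<sigma>" "\<pi>2 \<in> cyc \<pi>" "\<sigma>2 \<in> cyc \<sigma>" "(\<pi>1, \<sigma>1) \<noteq> (\<pi>2, \<sigma>2)" for \<pi>1 \<sigma>1 \<pi>2 \<sigma>2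
    using that set_cyc by (auto simp: Sh_eq[OF d'])
  have "(\<Sum>\<pi>' \<in> cyc \<pi>. \<Sum>\<sigma>' \<in> cyc \<sigma>. \<Sum>\<tau> \<in> Sh \<pi>' \<sigma>'. F \<tau>) =
      (\<Sum>p \<in> cyc \<pi> \<times> cyc \<sigma>. \<Sum>\<tau> \<in> Sh (fst p) (snd p). F \<tau>)"
    by (simp add: sum.cartesian_product case_prod_beta)
  also have "\<dots> = (\<Sum>\<tau> \<in> rot_shuffles \<pi> \<sigma>. F \<tau>)"
    unfolding rot_shuffles_def case_prod_beta
    by (rule sum.UNION_disjoint[symmetric]) (use disj in \<open>auto simp: finite_cyc finite_Sh[OF d']\<close>)
  also have "rot_shuffles \<pi> \<sigma> = (\<Union>T \<in> cSh (cyc \<pi>) (cyc \<sigma>). T)"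
    using rot_shuffles_cyc_closed[OF d] self_in_cyc by (auto simp: cSh_eq_image)
  also have "(\<Sum>\<tau> \<in> \<dots>. F \<tau>) = (\<Sum>T \<in> cSh (cyc \<pi>) (cyc \<sigma>). \<Sum>\<tau> \<in> T. F \<tau>)"
    by (rule sum.UNION_disjoint[OF finite_cSh[OF d]])
      (auto simp: cSh_eq_image finite_cyc dest: cyc_eq_if_mem)
  finally show ?thesis .
qed

lemma cyc_vec_mult:
  assumes "shuffle_compatible st" "disjoint_perms \<pi> \<sigma>"
  shows "bilin_ext (shuffle_prod st) (cyc_vec st (cyc \<pi>)) (cyc_vec st (cyc \<sigma>)) =
           (\<Sum>T \<in> cSh (cyc \<pi>) (cyc \<sigma>). cyc_vec st T)"
proof -
  have "bilin_ext (shuffle_prod st) (cyc_vec st (cyc \<pi>)) (cyc_vec st (cyc \<sigma>)) =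
      (\<Sum>\<pi>' \<in> cyc \<pi>. \<Sum>\<sigma>' \<in> cyc \<sigma>. shuffle_prod st (st_class st \<pi>') (st_class st \<sigma>'))"
    by (simp add: cyc_vec_def bilin_ext_sum_basis_vec)
  also have "\<dots> = (\<Sum>\<pi>' \<in> cyc \<pi>. \<Sum>\<sigma>' \<in> cyc \<sigma>. \<Sum>\<tau> \<in> Sh \<pi>' \<sigma>'. basis_vec (st_class st \<tau>))"
    by (intro sum.cong refl shuffle_prod_eq[OF assms(1)] disjoint_perms_cyc[OF assms(2)])
  finally show ?thesis by (simp add: sum_rot_shuffles[OF assms(2)] cyc_vec_def)
qed

lemma cSh_subset_cyc_perms: "cSh P Q \<subseteq> cyc_perms"
  by (auto simp: cSh_def cyc_perms_def Sh_def)

section \<open>Multisets of independent vectors\<close>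

text \<open>
  The coefficient of \<open>w\<close> in a sum of members of an independent set \<open>W\<close> is the number of summands equal
  to \<open>w\<close>. In characteristic zero this coefficient determines the number.
\<close>

lemma (in vector_space) image_mset_eq_if_sum_eq:
  assumes indep: "independent W" and "finite A" "finite A'"
    and W: "v ` A \<subseteq> W" "v ` A' \<subseteq> W" and eq: "(\<Sum>a \<in> A. v a) = (\<Sum>a \<in> A'. v a)"
    and of_nat: "inj (of_nat :: nat \<Rightarrow> 'a)"
  shows "image_mset v (mset_set A) = image_mset v (mset_set A')"
proof (rule multiset_eqI)
  fix w
  have count: "representation W (\<Sum>a \<in> D. v a) w = of_nat (count (image_mset v (mset_set D)) w)"
    if "finite D" "v ` D \<subseteq> W" for D
  proof -
    have "representation W (\<Sum>a \<in> D. v a) w = (\<Sum>a \<in> D. if v a = w then 1 else 0)"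
      using that by (subst representation_sum[OF indep])
        (auto simp: representation_basis[OF indep] span_base image_subset_iff intro!: sum.cong)
    also have "\<dots> = of_nat (card {a \<in> D. v a = w})"
      using that(1) by (simp add: sum.If_cases Int_def)
    also have "card {a \<in> D. v a = w} = count (image_mset v (mset_set D)) w"
      using that(1) by (auto simp: count_image_mset' intro!: arg_cong[of _ _ card])
    finally show ?thesis .
  qed
  show "count (image_mset v (mset_set A)) w = count (image_mset v (mset_set A')) w"
    using count[OF assms(2) W(1)] count[OF assms(3) W(2)] eq injD[OF of_nat] by metis
qed

section \<open>The isomorphism\<close>

text \<open>
  The hypothesis \<open>family_inj\<close> says that different classes of the cyclic statistic have different
  vectors. Together with the independence of the set of vectors it expresses that the family indexed
  by the classes is linearly independent.
\<close>

locale independent_cyclic_vectors =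
  fixes st :: "nat list \<Rightarrow> 'a" and cst :: "nat list set \<Rightarrow> 'b"
  assumes cst: "cyc_perm_statistic cst"
    and st: "perm_statistic st" and compatible: "shuffle_compatible st"
    and vec_cong: "\<And>P Q. P \<in> cyc_perms \<Longrightarrow> Q \<in> cyc_perms \<Longrightarrow> cst_equiv cst P Q \<Longrightarrow>
                     cyc_vec st P = cyc_vec st Q"
    and family_inj: "\<And>P Q. P \<in> cyc_perms \<Longrightarrow> Q \<in> cyc_perms \<Longrightarrow> cyc_vec st P = cyc_vec st Q \<Longrightarrow>
                       cst_equiv cst P Q"
    and family_indep: "freeQ.independent (cyc_vec st ` cyc_perms)"
begin

abbreviation vecs :: "(nat list set \<Rightarrow>\<^sub>0 rat) set" where
  "vecs \<equiv> cyc_vec st ` cyc_perms"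

abbreviation cst_classes :: "nat list set set set" where
  "cst_classes \<equiv> cst_class cst ` cyc_perms"

text \<open>
  Equivalent factors have the same vectors, hence the same product; by independence its summands
  form the same multiset.
\<close>

lemma cyc_shuffle_compatible: "cyc_shuffle_compatible cst"
  unfolding cyc_shuffle_compatible_def
proof (intro allI impI, elim conjE)
  fix \<pi> \<sigma> \<pi>' \<sigma>'
  assume d: "disjoint_perms \<pi> \<sigma>" and d': "disjoint_perms \<pi>' \<sigma>'"
    and "cst (cyc \<pi>) = cst (cyc \<pi>')" "cst (cyc \<sigma>) = cst (cyc \<sigma>')"
    and "length \<pi> = length \<pi>'" "length \<sigma> = length \<sigma>'"
  then have vec: "cyc_vec st (cyc \<pi>) = cyc_vec st (cyc \<pi>')" "cyc_vec st (cyc \<sigma>) = cyc_vec st (cyc \<sigma>')"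
    by (auto intro!: vec_cong simp: cst_equiv_def cyc_perms_def disjoint_perms_def)
  let ?C = "cSh (cyc \<pi>) (cyc \<sigma>)" and ?C' = "cSh (cyc \<pi>') (cyc \<sigma>')"
  have "(\<Sum>T \<in> ?C. cyc_vec st T) = (\<Sum>T \<in> ?C'. cyc_vec st T)"
    using cyc_vec_mult[OF compatible d] cyc_vec_mult[OF compatible d'] vec by simp
  then have mset: "image_mset (cyc_vec st) (mset_set ?C) = image_mset (cyc_vec st) (mset_set ?C')"
    by (intro freeQ.image_mset_eq_if_sum_eq[OF family_indep finite_cSh[OF d] finite_cSh[OF d']])
      (auto intro: subsetD[OF cSh_subset_cyc_perms] simp: inj_on_def)
  \<comment> \<open>By \<open>family_inj\<close> the cyclic statistic factors through the vectors, as the function \<open>c\<close>.\<close>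
  define c where "c v = cst (SOME P. P \<in> cyc_perms \<and> cyc_vec st P = v)" for v
  have c: "c (cyc_vec st P) = cst P" if "P \<in> cyc_perms" for P
  proof -
    have "(SOME Q. Q \<in> cyc_perms \<and> cyc_vec st Q = cyc_vec st P) \<in> cyc_perms \<and>
        cyc_vec st (SOME Q. Q \<in> cyc_perms \<and> cyc_vec st Q = cyc_vec st P) = cyc_vec st P"
      by (rule someI[of _ P]) (use that in simp)
    then show ?thesis unfolding c_def using family_inj that by (metis cst_equiv_def)
  qed
  have "image_mset cst (mset_set D) = image_mset c (image_mset (cyc_vec st) (mset_set D))"
    if "D \<subseteq> cyc_perms" "finite D" for D
    using that c by (auto simp: multiset.map_comp intro!: image_mset_cong)
  then show "image_mset cst (mset_set ?C) = image_mset cst (mset_set ?C')"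
    using mset cSh_subset_cyc_perms finite_cSh[OF d] finite_cSh[OF d'] by metis
qed

text \<open>
  The members of a class share one vector, so it does not matter which of them is chosen
  (\<open>psi_cst_class\<close>).
\<close>

definition psi :: "(nat list set set \<Rightarrow>\<^sub>0 rat) \<Rightarrow> (nat list set \<Rightarrow>\<^sub>0 rat)" where
  "psi = lin_ext (\<lambda>k. cyc_vec st (SOME P. P \<in> k))"

lemma linear_psi: "Vector_Spaces.linear scaleQ scaleQ psi"
  unfolding psi_def by (rule linear_lin_ext)

lemma psi_cst_class:
  assumes "P \<in> cyc_perms"
  shows "psi (basis_vec (cst_class cst P)) = cyc_vec st P"
proof -
  have "(SOME Q. Q \<in> cst_class cst P) \<in> cst_class cst P"
    by (rule someI[of _ P]) (use assms in \<open>simp add: cst_class_def cst_equiv_def\<close>)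
  then show ?thesis
    using vec_cong[OF assms, symmetric] by (simp add: psi_def) (simp add: cst_class_def)
qed

lemma psi_image_basis: "psi ` basis_vec ` cst_classes = vecs"
  by (simp add: image_image psi_cst_class)

text \<open>
  The images of the distinct basis vectors are distinct and form an independent set.
\<close>

lemma bij_betw_psi: "bij_betw psi {f. Poly_Mapping.keys f \<subseteq> cst_classes} (freeQ.span vecs)"
  unfolding bij_betw_def span_basis_vec[symmetric]
proof
  interpret Vector_Spaces.linear scaleQ scaleQ psi by (rule linear_psi)
  have "inj_on psi (basis_vec ` cst_classes)"
  proof (rule inj_onI; clarify)
    fix P Q assume PQ: "P \<in> cyc_perms" "Q \<in> cyc_perms"
      and "psi (basis_vec (cst_class cst P)) = psi (basis_vec (cst_class cst Q))"
    then have "cst_equiv cst P Q" by (intro family_inj) (simp_all add: psi_cst_class)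
    then have "cst_class cst P = cst_class cst Q" by (simp add: cst_class_def cst_equiv_def)
    then show "basis_vec (cst_class cst P) = basis_vec (cst_class cst Q)" by simp
  qed
  then show "inj_on psi (freeQ.span (basis_vec ` cst_classes))"
    using inj_on_span_iff_independent_image[of "basis_vec ` cst_classes"] family_indep
    by (simp add: psi_image_basis)
  show "psi ` freeQ.span (basis_vec ` cst_classes) = freeQ.span vecs"
    using span_image[of "basis_vec ` cst_classes"] by (simp add: psi_image_basis)
qed

lemma cst_class_representative:
  assumes "b \<in> cst_classes" "finite A"
  obtains \<pi> where "lin_perm \<pi>" "b = cst_class cst (cyc \<pi>)" "set \<pi> \<inter> A = {}"
proof -
  obtain \<pi> where \<pi>: "lin_perm \<pi>" "b = cst_class cst (cyc \<pi>)" using assms(1) by (auto simp: cyc_perms_def)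
  obtain \<pi>' where \<pi>': "lin_perm \<pi>'" "same_relative_order \<pi>' \<pi>" "set \<pi>' \<inter> A = {}"
    using ex_same_order_disjoint[OF \<pi>(1) assms(2)] .
  have "cst (cyc \<pi>') = cst (cyc \<pi>)" using cst \<pi> \<pi>' by (auto simp: cyc_perm_statistic_def)
  then have "b = cst_class cst (cyc \<pi>')"
    using \<pi>(2) same_relative_order_length[OF \<pi>'(2)] by (simp add: cst_class_def cst_equiv_def)
  then show thesis using that \<pi>' by blast
qed

lemma cst_class_disjoint_representatives:
  assumes "b \<in> cst_classes" "c \<in> cst_classes"
  obtains \<pi> \<sigma> where "disjoint_perms \<pi> \<sigma>" "b = cst_class cst (cyc \<pi>)" "c = cst_class cst (cyc \<sigma>)"
proof -
  obtain \<pi> where \<pi>: "lin_perm \<pi>" "b = cst_class cst (cyc \<pi>)"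
    using cst_class_representative[OF assms(1), of "{}"] by auto
  obtain \<sigma> where "lin_perm \<sigma>" "c = cst_class cst (cyc \<sigma>)" "set \<sigma> \<inter> set \<pi> = {}"
    using cst_class_representative[OF assms(2), of "set \<pi>"] by auto
  with \<pi> show thesis by (intro that) (auto simp: disjoint_perms_def)
qed

lemma keys_cyc_shuffle_prod:
  assumes "b \<in> cst_classes" "c \<in> cst_classes"
  shows "Poly_Mapping.keys (cyc_shuffle_prod cst b c) \<subseteq> cst_classes"
proof -
  obtain \<pi> \<sigma> where "disjoint_perms \<pi> \<sigma>" "b = cst_class cst (cyc \<pi>)" "c = cst_class cst (cyc \<sigma>)"
    using cst_class_disjoint_representatives[OF assms] .
  then show ?thesis
    by (simp add: cyc_shuffle_prod_eq[OF cyc_shuffle_compatible])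
      (rule keys_sum_subset, use cSh_subset_cyc_perms in auto)
qed

text \<open>
  By bilinearity it suffices to compare products of basis vectors, where this is \<open>cyc_vec_mult\<close> for
  disjoint representatives.
\<close>

lemma psi_mult:
  assumes "Poly_Mapping.keys f \<subseteq> cst_classes" "Poly_Mapping.keys g \<subseteq> cst_classes"
  shows "psi (bilin_ext (cyc_shuffle_prod cst) f g) = bilin_ext (shuffle_prod st) (psi f) (psi g)"
proof (rule bilin_eq_on_keys[OF _ _ _ _ _ assms])
  fix b c assume "b \<in> cst_classes" "c \<in> cst_classes"
  then obtain \<pi> \<sigma> where d: "disjoint_perms \<pi> \<sigma>"
    and eq: "b = cst_class cst (cyc \<pi>)" "c = cst_class cst (cyc \<sigma>)"
    using cst_class_disjoint_representatives by blast
  have cyc: "cyc \<pi> \<in> cyc_perms" "cyc \<sigma> \<in> cyc_perms"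
    using d by (auto simp: cyc_perms_def disjoint_perms_def)
  have "psi (cyc_shuffle_prod cst b c) =
      (\<Sum>T \<in> cSh (cyc \<pi>) (cyc \<sigma>). psi (basis_vec (cst_class cst T)))"
    by (simp add: eq cyc_shuffle_prod_eq[OF cyc_shuffle_compatible d] psi_def lin_ext_sum)
  also have "\<dots> = (\<Sum>T \<in> cSh (cyc \<pi>) (cyc \<sigma>). cyc_vec st T)"
    by (intro sum.cong refl psi_cst_class subsetD[OF cSh_subset_cyc_perms])
  also have "\<dots> = bilin_ext (shuffle_prod st) (psi (basis_vec b)) (psi (basis_vec c))"
    by (simp add: cyc_vec_mult[OF compatible d] eq psi_cst_class cyc)
  finally show "psi (bilin_ext (cyc_shuffle_prod cst) (basis_vec b) (basis_vec c)) =
      bilin_ext (shuffle_prod st) (psi (basis_vec b)) (psi (basis_vec c))" by simp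
qed (intro linear_comp[OF linear_psi linear_bilin_ext_left] linear_comp[OF linear_psi linear_bilin_ext_right]
    linear_comp[OF linear_bilin_ext_left linear_psi] linear_comp[OF linear_bilin_ext_right linear_psi])+

lemma psi_one: "psi (basis_vec (cst_class cst (cyc []))) = basis_vec (st_class st [])"
  by (simp add: psi_cst_class[OF cyc_Nil_in_cyc_perms]) (simp add: cyc_vec_def cyc_Nil)

lemma span_vecs_subset: "freeQ.span vecs \<subseteq> {f. Poly_Mapping.keys f \<subseteq> st_classes st}"
proof -
  have "vecs \<subseteq> {f. Poly_Mapping.keys f \<subseteq> st_classes st}"
  proof clarify
    fix P :: "nat list set" and b assume P: "P \<in> cyc_perms" and b: "b \<in> Poly_Mapping.keys (cyc_vec st P)"
    have "Poly_Mapping.keys (cyc_vec st P) \<subseteq> st_classes st"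
      unfolding cyc_vec_def by (rule keys_sum_subset) (use P lin_perm_cyc in \<open>auto simp: cyc_perms_def\<close>)
    with b show "b \<in> st_classes st" by blast
  qed
  then show ?thesis
    unfolding span_basis_vec[symmetric] by (intro freeQ.span_minimal freeQ.subspace_span)
qed

lemma psi_range: "Poly_Mapping.keys f \<subseteq> cst_classes \<Longrightarrow> psi f \<in> freeQ.span vecs"
  using bij_betw_psi by (auto simp: bij_betw_def)

lemma psi_inj:
  "psi f = psi g \<Longrightarrow> Poly_Mapping.keys f \<subseteq> cst_classes \<Longrightarrow> Poly_Mapping.keys g \<subseteq> cst_classes \<Longrightarrow> f = g"
  using bij_betw_psi by (auto simp: bij_betw_def inj_on_def)

lemma psi_preimage:
  assumes "v \<in> freeQ.span vecs"
  obtains f where "Poly_Mapping.keys f \<subseteq> cst_classes" "v = psi f"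
  using assms bij_betw_psi unfolding bij_betw_def by blast

text \<open>
  Closure under multiplication is the nontrivial part: by \<open>psi_mult\<close> the product of two members of the
  image of \<open>psi\<close> lies in that image.
\<close>

lemma span_vecs_subalgebra: "is_subalgebra (freeQ.span vecs) rat_field (shuffle_algebra st)"
proof -
  let ?A = "shuffle_algebra st"
  have alg: "algebra rat_field ?A" by (rule shuffle_algebra_is_algebra[OF st compatible])
  interpret A: algebra rat_field ?A by (rule alg)
  have carrier: "freeQ.span vecs \<subseteq> carrier ?A"
    using span_vecs_subset by (simp add: shuffle_algebra_def based_algebra_simps)
  have a_inv: "\<ominus>\<^bsub>?A\<^esub> v \<in> freeQ.span vecs" if "v \<in> freeQ.span vecs" for v
  proof -
    have "Poly_Mapping.keys v \<subseteq> st_classes st" using that span_vecs_subset by blast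
    then have "\<ominus>\<^bsub>?A\<^esub> v = - v"
      unfolding shuffle_algebra_def by (rule based_algebra_a_inv[OF alg[unfolded shuffle_algebra_def]])
    then show ?thesis using that by (simp add: freeQ.span_neg)
  qed
  have mult: "v \<otimes>\<^bsub>?A\<^esub> w \<in> freeQ.span vecs" if vw: "v \<in> freeQ.span vecs" "w \<in> freeQ.span vecs" for v w
  proof -
    obtain f g where fg: "Poly_Mapping.keys f \<subseteq> cst_classes" "v = psi f"
      "Poly_Mapping.keys g \<subseteq> cst_classes" "w = psi g"
      using psi_preimage vw by metis
    have "v \<otimes>\<^bsub>?A\<^esub> w = psi (bilin_ext (cyc_shuffle_prod cst) f g)"
      using fg by (simp add: shuffle_algebra_def based_algebra_simps psi_mult)
    then show ?thesis
      using psi_range[OF keys_bilin_ext_subset[OF keys_cyc_shuffle_prod fg(1,3)]] by simp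
  qed
  have one: "\<one>\<^bsub>?A\<^esub> \<in> freeQ.span vecs"
    using psi_range[of "basis_vec (cst_class cst (cyc []))"] cyc_Nil_in_cyc_perms
    by (simp add: shuffle_algebra_def based_algebra_simps psi_one)
  have add: "v \<oplus>\<^bsub>?A\<^esub> w \<in> freeQ.span vecs" if "v \<in> freeQ.span vecs" "w \<in> freeQ.span vecs" for v w
    using that by (simp add: shuffle_algebra_def based_algebra_simps freeQ.span_add)
  have "subring (freeQ.span vecs) ?A"
    by (rule ring.subringI[OF cring.axioms(1)[OF A.M_cring]]) (fact carrier one a_inv mult add)+
  moreover have "submodule (freeQ.span vecs) rat_field ?A"
  proof (rule A.submoduleI)
    show "\<zero>\<^bsub>?A\<^esub> \<in> freeQ.span vecs"
      by (simp add: shuffle_algebra_def based_algebra_simps freeQ.span_zero)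
    show "c \<odot>\<^bsub>?A\<^esub> v \<in> freeQ.span vecs" if "v \<in> freeQ.span vecs" for c v
      using that by (simp add: shuffle_algebra_def based_algebra_simps freeQ.span_scale)
  qed (fact carrier a_inv add)+
  ultimately show ?thesis using alg by (simp add: is_subalgebra_def)
qed

text \<open>
  Each law is an identity between vectors supported on the classes, and \<open>psi\<close> maps it to the same
  law of the shuffle algebra. As \<open>psi\<close> is injective on such vectors, the law holds.
\<close>

lemma cyc_shuffle_algebra_is_algebra: "algebra rat_field (cyc_shuffle_algebra cst)"
  unfolding cyc_shuffle_algebra_def
proof (rule based_algebra_is_algebra)
  interpret A: algebra rat_field "shuffle_algebra st"
    by (rule shuffle_algebra_is_algebra[OF st compatible])
  let ?m = "cyc_shuffle_prod cst"
  note simps = shuffle_algebra_def based_algebra_simps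
  show e: "cst_class cst (cyc []) \<in> cst_classes" using cyc_Nil_in_cyc_perms by blast
  have carrier: "psi (basis_vec b) \<in> carrier (shuffle_algebra st)" if "b \<in> cst_classes" for b
    using psi_range[of "basis_vec b"] span_vecs_subset that by (auto simp: simps)
  have psi_prod: "psi (?m b c) = psi (basis_vec b) \<otimes>\<^bsub>shuffle_algebra st\<^esub> psi (basis_vec c)"
    if "b \<in> cst_classes" "c \<in> cst_classes" for b c
    using psi_mult[of "basis_vec b" "basis_vec c"] that by (simp add: simps)
  fix b c assume b: "b \<in> cst_classes" and c: "c \<in> cst_classes"
  show "Poly_Mapping.keys (?m b c) \<subseteq> cst_classes" by (rule keys_cyc_shuffle_prod[OF b c])
  show "?m b c = ?m c b"
    by (rule psi_inj) (simp_all add: psi_prod b c carrier keys_cyc_shuffle_prod A.m_comm)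
  have "psi (basis_vec (cst_class cst (cyc []))) = \<one>\<^bsub>shuffle_algebra st\<^esub>"
    by (simp add: psi_one simps)
  then show "?m (cst_class cst (cyc [])) b = basis_vec b"
    by (intro psi_inj) (simp_all add: psi_prod b e carrier keys_cyc_shuffle_prod)
  fix d assume d: "d \<in> cst_classes"
  show "bilin_ext ?m (?m b c) (basis_vec d) = bilin_ext ?m (basis_vec b) (?m c d)"
  proof (rule psi_inj)
    have "psi (bilin_ext ?m (?m b c) (basis_vec d)) =
        psi (?m b c) \<otimes>\<^bsub>shuffle_algebra st\<^esub> psi (basis_vec d)"
      using b c d by (simp add: psi_mult keys_cyc_shuffle_prod simps)
    also have "\<dots> = psi (basis_vec b) \<otimes>\<^bsub>shuffle_algebra st\<^esub> psi (?m c d)"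
      by (simp add: psi_prod b c d carrier A.m_assoc)
    also have "\<dots> = psi (bilin_ext ?m (basis_vec b) (?m c d))"
      using b c d by (simp add: psi_mult keys_cyc_shuffle_prod simps)
    finally show "psi (bilin_ext ?m (?m b c) (basis_vec d)) =
        psi (bilin_ext ?m (basis_vec b) (?m c d))" .
  qed (use b c d in \<open>simp_all add: keys_bilin_ext_subset keys_cyc_shuffle_prod\<close>)
qed

lemma psi_algebra_iso:
  "is_algebra_iso rat_field (cyc_shuffle_algebra cst)
     (shuffle_algebra st\<lparr>carrier := freeQ.span vecs\<rparr>) psi"
  unfolding is_algebra_iso_def
proof (intro conjI ballI)
  note simps = shuffle_algebra_def cyc_shuffle_algebra_def based_algebra_simps
  show "algebra rat_field (cyc_shuffle_algebra cst)" by (rule cyc_shuffle_algebra_is_algebra)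
  show "algebra rat_field (shuffle_algebra st\<lparr>carrier := freeQ.span vecs\<rparr>)"
    by (rule subalgebra_imp_algebra[OF span_vecs_subalgebra])
  show "psi \<in> ring_iso (cyc_shuffle_algebra cst) (shuffle_algebra st\<lparr>carrier := freeQ.span vecs\<rparr>)"
    using bij_betw_psi
    by (auto simp: ring_iso_def ring_hom_def simps psi_range psi_mult psi_one)
      (simp add: psi_def lin_ext_add)
  show "psi (c \<odot>\<^bsub>cyc_shuffle_algebra cst\<^esub> x) =
      c \<odot>\<^bsub>shuffle_algebra st\<lparr>carrier := freeQ.span vecs\<rparr>\<^esub> psi x" for c x
    by (simp add: simps psi_def lin_ext_scaleQ)
qed

end

theorem theorem2p8:
  fixes st :: "nat list \<Rightarrow> 'a" and cst :: "nat list set \<Rightarrow> 'b"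
  assumes "cyc_perm_statistic cst"
    and "perm_statistic st" and "shuffle_compatible st"
    and vec_cong: "\<And>P Q. P \<in> cyc_perms \<Longrightarrow> Q \<in> cyc_perms \<Longrightarrow> cst_equiv cst P Q \<Longrightarrow>
                     cyc_vec st P = cyc_vec st Q"
    and family_inj: "\<And>P Q. P \<in> cyc_perms \<Longrightarrow> Q \<in> cyc_perms \<Longrightarrow> cyc_vec st P = cyc_vec st Q \<Longrightarrow>
                       cst_equiv cst P Q"
    and family_indep: "freeQ.independent (cyc_vec st ` cyc_perms)"
  shows "cyc_shuffle_compatible cst \<and>
    is_subalgebra (freeQ.span (cyc_vec st ` cyc_perms)) rat_field (shuffle_algebra st) \<and>
    (\<exists>\<psi>. (\<forall>P \<in> cyc_perms. \<psi> (Poly_Mapping.single (cst_class cst P) 1) = cyc_vec st P) \<and>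
         is_algebra_iso rat_field (cyc_shuffle_algebra cst)
           (shuffle_algebra st\<lparr>carrier := freeQ.span (cyc_vec st ` cyc_perms)\<rparr>) \<psi>)"
proof -
  interpret independent_cyclic_vectors st cst by unfold_locales (fact assms)+
  show ?thesis
    using cyc_shuffle_compatible span_vecs_subalgebra psi_cst_class psi_algebra_iso by blast
qed

end
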